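(* If $f\in C^{\infty}([0,1])$, then there exists a positive constant $c$ such that for all $\alpha>1$ and all $n\in\mathbb{N}$ satisfying $$(n-1)\left(\ln(n+1+e)-1\right)\geq\ln\alpha,$$ one has $$\mathcal{E}^{\alpha}_{n}[f]\leq c\,(n+1)^{-1/2}(2\alpha)^{-n-1}\|f\|_{(n-1)n+1}.$$ Moreover, for $n\in\mathbb{N}$ with $n>1$, there holds the estimate $$\mathcal{N}\left(\mathcal{Q}^{\alpha}_{n}[f]\right)\leq n(n-1)\ln n+n^2+n.$$
   Context: $\mathbb{N}=\{1,2,\ldots\}$, $I=[0,1]$, $\hat I=[-1,1]$, $e$ is Euler's number, $\|\varphi\|_\infty$ denotes the maximum of $|\varphi|$ over its domain, and for a $C^\infty$ function $\phi$ and $n\in\mathbb{N}$, $\|\phi\|_n:=\max\{\|\phi^{(j)}\|_\infty: j=0,1,\ldots,n\}$. Integrals: for $\alpha>0$, $\beta\in\mathbb{R}$ let $G_{\alpha,\beta}(x)=e^{-\alpha^2(x-\beta)^2}$ and $G_\alpha=G_{\alpha,0}$. For continuous $f$ on $[0,1]$, $\mathcal{I}_\alpha[f]=\int_0^1 f(x)G_\alpha(x)\,dx$; for continuous $g$ on $[-1,1]$, $\mathcal{I}_{\alpha,\beta}[g]=\int_{-1}^1 g(x)G_{\alpha,\beta}(x)\,dx$. Basic quadrature formula: for $m\in\mathbb{N}$ and $g\in C([-1,1])$, let $p_m$ be the Lagrange interpolation polynomial (of degree at most $m$) of $g$ at the $m+1$ Chebyshev points of the first kind $\cos\left((2i+1)\pi/(2m+2)\right)$,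 $i=0,1,\ldots,m$. Set $\mathcal{Q}^{\alpha,\beta}_m[g]:=\mathcal{I}_{\alpha,\beta}[p_m]$; it uses $m+1$ quadrature nodes. Graded mesh: for $\alpha>1$ and $n>1$ put $x_0=0$ and $x_j=\alpha^{(j-1)/(n-1)-1}$ for $j=1,\ldots,n$, and $h_j=x_j-x_{j-1}$. For $j=1,\ldots,n$ let $\alpha_j=\alpha h_j/2$, $\beta_j=-(x_{j-1}+x_j)/h_j$, and $f_j(x)=\frac{h_j}{2}f\left(\frac{h_j}{2}x+\frac{x_{j-1}+x_j}{2}\right)$ for $x\in[-1,1]$ (so that $\mathcal{I}_\alpha[f]=\sum_{j=1}^n\mathcal{I}_{\alpha_j,\beta_j}[f_j]$). Composite quadrature with variable numbers of nodes: let $m_j:=\left\lceil\frac{n(n-1)}{n+1-j}\right\rceil$ for $j=1,\ldots,n$, and $\mathcal{Q}^{\alpha}_{n}[f]:=\sum_{j=1}^n\mathcal{Q}^{\alpha_j,\beta_j}_{m_j}[f_j]$. Its error is $\mathcal{E}^{\alpha}_{n}[f]:=\left|\mathcal{I}_\alpha[f]-\mathcal{Q}^{\alpha}_{n}[f]\right|$, and $\mathcal{N}(\mathcal{Q}^{\alpha}_{n}[f])$ is the total number of quadrature nodes used, i.e. $\sum_{j=1}^n(m_j+1)$. (The displayed condition on $n$ and $\alpha>1$ forces $n>1$.) *)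

theory Defs
  imports "HOL-Analysis.Analysis" "HOL-Computational_Algebra.Polynomial"
begin

text \<open>
  Functions on a closed interval \<open>S\<close> are modelled as total functions \<open>real \<Rightarrow> real\<close> whose values
  outside \<open>S\<close> are irrelevant. All derivatives are therefore taken within \<open>S\<close>; they are one-sided
  at the end points.
\<close>

primrec nth_deriv_on :: "real set \<Rightarrow> nat \<Rightarrow> (real \<Rightarrow> real) \<Rightarrow> real \<Rightarrow> real" where
  "nth_deriv_on S 0 f = f"
| "nth_deriv_on S (Suc k) f = (\<lambda>x. vector_derivative (nth_deriv_on S k f) (at x within S))"

text \<open>
  Continuity of each derivative follows from its differentiability.
\<close>

definition smooth_fun_on :: "real set \<Rightarrow> (real \<Rightarrow> real) \<Rightarrow> bool" where
  "smooth_fun_on S f \<longleftrightarrow> (\<forall>k. nth_deriv_on S k f differentiable_on S)"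

text \<open>
  On a nonempty compact \<open>S\<close> the supremum below is the maximum of \<open>\<bar>\<phi>\<bar>\<close> for continuous \<open>\<phi>\<close>
  (\<open>Max\<close> itself is only meaningful for finite sets).
\<close>

definition sup_norm_on :: "real set \<Rightarrow> (real \<Rightarrow> real) \<Rightarrow> real" where
  "sup_norm_on S \<phi> = (SUP x\<in>S. \<bar>\<phi> x\<bar>)"

definition C_norm_on :: "real set \<Rightarrow> nat \<Rightarrow> (real \<Rightarrow> real) \<Rightarrow> real" where
  "C_norm_on S n \<phi> = Max ((\<lambda>j. sup_norm_on S (nth_deriv_on S j \<phi>)) ` {0..n})"

definition gauss :: "real \<Rightarrow> real \<Rightarrow> real \<Rightarrow> real" where
  "gauss \<alpha> \<beta> x = exp (- (\<alpha>\<^sup>2 * (x - \<beta>)\<^sup>2))"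

definition gauss_int :: "real \<Rightarrow> (real \<Rightarrow> real) \<Rightarrow> real" where
  "gauss_int \<alpha> f = integral {0..1} (\<lambda>x. f x * gauss \<alpha> 0 x)"

definition gauss_int_shift :: "real \<Rightarrow> real \<Rightarrow> (real \<Rightarrow> real) \<Rightarrow> real" where
  "gauss_int_shift \<alpha> \<beta> g = integral {-1..1} (\<lambda>x. g x * gauss \<alpha> \<beta> x)"

definition cheb_node :: "nat \<Rightarrow> nat \<Rightarrow> real" where
  "cheb_node m i = cos ((2 * real i + 1) * pi / (2 * real m + 2))"

definition lagrange_basis :: "(nat \<Rightarrow> real) \<Rightarrow> nat \<Rightarrow> nat \<Rightarrow> real poly" where
  "lagrange_basis t m i = (\<Prod>k\<in>{0..m} - {i}. smult (1 / (t i - t k)) [:- t k, 1:])"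

definition lagrange_poly :: "(nat \<Rightarrow> real) \<Rightarrow> nat \<Rightarrow> (real \<Rightarrow> real) \<Rightarrow> real poly" where
  "lagrange_poly t m g = (\<Sum>i=0..m. smult (g (t i)) (lagrange_basis t m i))"

lemma degree_lagrange_poly: "degree (lagrange_poly t m g) \<le> m"
proof -
  have "degree (lagrange_basis t m i) \<le> m" if "i \<le> m" for i
  proof -
    have "degree (lagrange_basis t m i)
        \<le> (\<Sum>k\<in>{0..m} - {i}. degree (smult (1 / (t i - t k)) [:- t k, 1:]))"
      unfolding lagrange_basis_def by (rule order_trans[OF degree_prod_sum_le]) (simp_all add: o_def)
    also have "\<dots> \<le> (\<Sum>k\<in>{0..m} - {i}. 1)"
      by (intro sum_mono) auto
    also have "\<dots> = m" using that by simp
    finally show ?thesis .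
  qed
  then show ?thesis
    unfolding lagrange_poly_def
    by (intro degree_sum_le) (auto intro: order_trans[OF degree_smult_le])
qed

lemma poly_lagrange_poly:
  assumes "inj_on t {0..m}" "l \<le> m"
  shows "poly (lagrange_poly t m g) (t l) = g (t l)"
proof -
  have "poly (lagrange_basis t m i) (t l) = (if i = l then 1 else 0)" if "i \<le> m" for i
  proof (cases "i = l")
    case True
    then show ?thesis
      using assms by (auto simp: lagrange_basis_def poly_prod inj_on_def
          diff_divide_distrib[symmetric] split: if_splits intro!: prod.neutral)
  next
    case False
    then show ?thesis
      using assms(2) by (auto simp: lagrange_basis_def poly_prod)
  qed
  then have "poly (lagrange_poly t m g) (t l) = (\<Sum>i=0..m. if i = l then g (t i) else 0)"
    unfolding lagrange_poly_def poly_sum by (intro sum.cong) auto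
  also have "\<dots> = g (t l)" using assms(2) by simp
  finally show ?thesis .
qed

definition basic_quad :: "real \<Rightarrow> real \<Rightarrow> nat \<Rightarrow> (real \<Rightarrow> real) \<Rightarrow> real" where
  "basic_quad \<alpha> \<beta> m g = gauss_int_shift \<alpha> \<beta> (poly (lagrange_poly (cheb_node m) m g))"

definition mesh :: "real \<Rightarrow> nat \<Rightarrow> nat \<Rightarrow> real" where
  "mesh \<alpha> n j = (if j = 0 then 0 else \<alpha> powr ((real j - 1) / (real n - 1) - 1))"

text \<open>The following definitions are only used for indices \<open>1 \<le> j \<le> n\<close>.\<close>

definition mesh_step :: "real \<Rightarrow> nat \<Rightarrow> nat \<Rightarrow> real" where
  "mesh_step \<alpha> n j = mesh \<alpha> n j - mesh \<alpha> n (j - 1)"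

definition loc_alpha :: "real \<Rightarrow> nat \<Rightarrow> nat \<Rightarrow> real" where
  "loc_alpha \<alpha> n j = \<alpha> * mesh_step \<alpha> n j / 2"

definition loc_beta :: "real \<Rightarrow> nat \<Rightarrow> nat \<Rightarrow> real" where
  "loc_beta \<alpha> n j = - (mesh \<alpha> n (j - 1) + mesh \<alpha> n j) / mesh_step \<alpha> n j"

definition loc_fun :: "real \<Rightarrow> nat \<Rightarrow> nat \<Rightarrow> (real \<Rightarrow> real) \<Rightarrow> real \<Rightarrow> real" where
  "loc_fun \<alpha> n j f x =
     mesh_step \<alpha> n j / 2 * f (mesh_step \<alpha> n j / 2 * x + (mesh \<alpha> n (j - 1) + mesh \<alpha> n j) / 2)"

definition loc_degree :: "nat \<Rightarrow> nat \<Rightarrow> nat" where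
  "loc_degree n j = nat \<lceil>real n * (real n - 1) / (real n + 1 - real j)\<rceil>"

definition comp_quad :: "real \<Rightarrow> nat \<Rightarrow> (real \<Rightarrow> real) \<Rightarrow> real" where
  "comp_quad \<alpha> n f =
     (\<Sum>j=1..n. basic_quad (loc_alpha \<alpha> n j) (loc_beta \<alpha> n j) (loc_degree n j) (loc_fun \<alpha> n j f))"

definition comp_quad_error :: "real \<Rightarrow> nat \<Rightarrow> (real \<Rightarrow> real) \<Rightarrow> real" where
  "comp_quad_error \<alpha> n f = \<bar>gauss_int \<alpha> f - comp_quad \<alpha> n f\<bar>"

text \<open>
  A basic formula of degree \<open>m\<close> uses \<open>m + 1\<close> nodes, so the total number of nodes of
  \<open>comp_quad \<alpha> n f\<close> depends on \<open>n\<close> only.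
\<close>

definition comp_quad_nodes :: "nat \<Rightarrow> nat" where
  "comp_quad_nodes n = (\<Sum>j=1..n. loc_degree n j + 1)"

end

theory Submission
  imports Defs
begin

text \<open>
  The error on the \<open>j\<close>-th subinterval is at most the Chebyshev interpolation error times the mass
  that the Gaussian puts there, and these masses add up to at most \<open>2 / \<alpha>\<close>, which gives the last
  power of \<open>\<alpha>\<close>. With \<open>\<theta> = \<alpha> powr (1 / (n - 1))\<close> and \<open>k = n + 1 - j\<close> the subintervals with \<open>j \<ge> 2\<close> have
  length \<open>(\<theta> - 1) / \<theta> ^ k\<close>. The degrees \<open>m\<close> satisfy \<open>k * m \<ge> n * (n - 1)\<close>, so that \<open>\<theta> ^ (k * m)\<close>
  is at least \<open>\<alpha> ^ n\<close>, and the condition on \<open>n\<close> says that \<open>\<theta> - 1 \<le> (n + 1) / e\<close>, so that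
  \<open>(\<theta> - 1) ^ (m + 1)\<close> is absorbed by \<open>(m + 1)!\<close>.
\<close>

subsection \<open>Interpolation at the Chebyshev nodes\<close>

text \<open>Rolle between consecutive zeros of \<open>D 0\<close> gives an increasing chain of zeros
  of \<open>D 1\<close>, shorter by one, so induction applies to the shifted family. Passing the
  derivatives as a family \<open>D\<close> admits one-sided derivatives at the end points.\<close>

lemma iterated_rolle:
  fixes D :: "nat \<Rightarrow> real \<Rightarrow> real"
  assumes "\<And>i x. i < N \<Longrightarrow> x \<in> {a..b} \<Longrightarrow> (D i has_real_derivative D (Suc i) x) (at x within {a..b})"
    and "\<And>i. i < N \<Longrightarrow> z i < z (Suc i)"
    and "\<And>i. i \<le> N \<Longrightarrow> z i \<in> {a..b}"
    and "\<And>i. i \<le> N \<Longrightarrow> D 0 (z i) = 0"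
  shows "\<exists>\<xi>\<in>{a..b}. D N \<xi> = 0"
  using assms
proof (induction N arbitrary: D z)
  case 0
  then show ?case by auto
next
  case (Suc N)
  have "\<exists>w. z i < w \<and> w < z (Suc i) \<and> D 1 w = 0" if "i \<le> N" for i
  proof -
    have sub: "{z i..z (Suc i)} \<subseteq> {a..b}"
      using Suc.prems(3)[of i] Suc.prems(3)[of "Suc i"] that by auto
    have der: "(D 0 has_real_derivative D 1 x) (at x)" if "z i < x" "x < z (Suc i)" for x
    proof -
      have "(D 0 has_real_derivative D 1 x) (at x within {a..b})"
        using Suc.prems(1)[of 0 x] sub that by auto
      \<comment> \<open>Strictly between two zeros the point is interior, so the one-sided
        derivative is the ordinary one that Rolle requires.\<close>
      moreover have "at x within {a..b} = at x"
        using sub that Suc.prems(3)[of i] Suc.prems(3)[of "Suc i"] \<open>i \<le> N\<close>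
        by (intro at_within_interior) auto
      ultimately show ?thesis by simp
    qed
    have "continuous_on {a..b} (D 0)"
      using Suc.prems(1)[of 0] by (intro DERIV_continuous_on) auto
    then have cont: "continuous_on {z i..z (Suc i)} (D 0)"
      using sub by (rule continuous_on_subset)
    have "\<exists>w. z i < w \<and> w < z (Suc i) \<and> (D 0 has_real_derivative 0) (at w)"
    proof (rule Rolle)
      show "z i < z (Suc i)" using Suc.prems(2)[of i] that by simp
      show "D 0 (z i) = D 0 (z (Suc i))"
        using Suc.prems(4)[of i] Suc.prems(4)[of "Suc i"] that by simp
      show "D 0 differentiable (at x)" if "z i < x" "x < z (Suc i)" for x
        using der[OF that] real_differentiable_def by blast
    qed (rule cont)
    then show ?thesis using der DERIV_unique by blast
  qed
  then obtain w where w: "\<And>i. i \<le> N \<Longrightarrow> z i < w i \<and> w i < z (Suc i) \<and> D 1 (w i) = 0"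
    by metis
  have "\<exists>\<xi>\<in>{a..b}. (\<lambda>i. D (Suc i)) N \<xi> = 0"
  proof (rule Suc.IH[of "\<lambda>i. D (Suc i)" w])
    show "w i < w (Suc i)" if "i < N" for i
      using w[of i] w[of "Suc i"] that by simp
    show "w i \<in> {a..b}" if "i \<le> N" for i
      using w[OF that] Suc.prems(3)[of i] Suc.prems(3)[of "Suc i"] that by auto
  qed (use Suc.prems(1) w in auto)
  then show ?case by simp
qed

lemma iterated_rolle_set:
  fixes D :: "nat \<Rightarrow> real \<Rightarrow> real"
  assumes "\<And>i x. i < N \<Longrightarrow> x \<in> {a..b} \<Longrightarrow> (D i has_real_derivative D (Suc i) x) (at x within {a..b})"
    and Z: "finite Z" "card Z = Suc N" "Z \<subseteq> {a..b}"
    and zero: "\<And>x. x \<in> Z \<Longrightarrow> D 0 x = 0"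
  shows "\<exists>\<xi>\<in>{a..b}. D N \<xi> = 0"
proof (rule iterated_rolle[where z = "\<lambda>i. sorted_list_of_set Z ! i"])
  have mem: "sorted_list_of_set Z ! i \<in> Z" if "i \<le> N" for i
    using Z that nth_mem[of i "sorted_list_of_set Z"] by simp
  show "sorted_list_of_set Z ! i \<in> {a..b}" if "i \<le> N" for i
    using mem[OF that] Z by auto
  show "D 0 (sorted_list_of_set Z ! i) = 0" if "i \<le> N" for i
    using mem[OF that] zero by auto
  show "sorted_list_of_set Z ! i < sorted_list_of_set Z ! Suc i" if "i < N" for i
    using Z that by (intro sorted_wrt_nth_less[OF strict_sorted_list_of_set]) auto
qed (rule assms(1))

lemma poly_higher_pderiv_degree:
  fixes p :: "real poly"
  assumes "degree p \<le> k"
  shows "poly ((pderiv ^^ k) p) x = fact k * coeff p k"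
proof -
  have "(pderiv ^^ k) p = [:fact k * coeff p k:]"
  proof (rule poly_eqI)
    fix n
    show "coeff ((pderiv ^^ k) p) n = coeff [:fact k * coeff p k:] n"
      using assms by (cases n) (simp_all add: coeff_higher_pderiv coeff_eq_0 pochhammer_fact)
  qed
  then show ?thesis by simp
qed

lemma degree_prod_linear: "degree (\<Prod>i\<in>A. [:- t i, 1:] :: real poly) = card A"
  by (subst degree_prod_sum_eq) auto

lemma coeff_prod_linear: "coeff (\<Prod>i\<in>A. [:- t i, 1:] :: real poly) (card A) = 1"
  using lead_coeff_prod[of "\<lambda>i. [:- t i, 1:] :: real poly" A] by (simp add: degree_prod_linear)

text \<open>Classical remainder argument: a multiple of the nodal polynomial is added to the
  interpolant so that the error also vanishes at \<open>x\<close>; Rolle then ties this multiple to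
  a value of the derivative of order \<open>Suc m\<close>.\<close>

lemma lagrange_error:
  fixes D :: "nat \<Rightarrow> real \<Rightarrow> real"
  assumes der: "\<And>i x. i \<le> m \<Longrightarrow> x \<in> {a..b} \<Longrightarrow>
      (D i has_real_derivative D (Suc i) x) (at x within {a..b})"
    and t: "inj_on t {0..m}" "t ` {0..m} \<subseteq> {a..b}"
    and B: "\<And>x. x \<in> {a..b} \<Longrightarrow> \<bar>D (Suc m) x\<bar> \<le> B"
    and x: "x \<in> {a..b}"
  shows "\<bar>D 0 x - poly (lagrange_poly t m (D 0)) x\<bar> \<le> B / fact (Suc m) * \<bar>\<Prod>i=0..m. x - t i\<bar>"
proof (cases "x \<in> t ` {0..m}")
  case True
  then obtain l where "l \<le> m" "x = t l" by auto
  then have "D 0 x - poly (lagrange_poly t m (D 0)) x = 0" "(\<Prod>i=0..m. x - t i) = 0"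
    using poly_lagrange_poly[OF t(1)] by (auto intro!: bexI[of _ l])
  then show ?thesis by (simp only: abs_zero mult_zero_right order_refl)
next
  case False
  define W where "W = (\<Prod>i\<in>{0..m}. [:- t i, 1:])"
  have W: "poly W y = (\<Prod>i=0..m. y - t i)" for y
    by (simp add: W_def poly_prod)
  have W0: "poly W x \<noteq> 0" using False by (auto simp: W)
  \<comment> \<open>The one value of \<open>K\<close> for which \<open>E 0\<close> below vanishes at
    \<open>x\<close> as well as at the nodes.\<close>
  define K where "K = (D 0 x - poly (lagrange_poly t m (D 0)) x) / poly W x"
  define Q where "Q = lagrange_poly t m (D 0) + smult K W"
  define E where "E i y = D i y - poly ((pderiv ^^ i) Q) y" for i y
  have degW: "degree W = Suc m"
    unfolding W_def degree_prod_linear by simp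
  have "coeff W (Suc m) = 1"
    using coeff_prod_linear[of t "{0..m}"] by (simp add: W_def)
  moreover have "coeff (lagrange_poly t m (D 0)) (Suc m) = 0"
    using degree_lagrange_poly[of t m "D 0"] by (intro coeff_eq_0) simp
  ultimately have cQ: "coeff Q (Suc m) = K" by (simp add: Q_def)
  have dQ: "degree Q \<le> Suc m"
    unfolding Q_def using degree_lagrange_poly[of t m "D 0"] degW
    by (intro degree_add_le) (auto intro: order_trans[OF degree_smult_le])
  \<comment> \<open>\<open>E 0\<close> has \<open>m + 2\<close> zeros: the \<open>m + 1\<close>
    nodes and \<open>x\<close>.\<close>
  have "\<exists>\<xi>\<in>{a..b}. E (Suc m) \<xi> = 0"
  proof (rule iterated_rolle_set)
    show "(E i has_real_derivative E (Suc i) y) (at y within {a..b})"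
      if "i < Suc m" "y \<in> {a..b}" for i y
      unfolding E_def using der[of i y] that
      by (auto intro!: DERIV_diff DERIV_subset[OF poly_DERIV])
    show "card (insert x (t ` {0..m})) = Suc (Suc m)"
      using False card_image[OF t(1)] by simp
    show "E 0 y = 0" if y: "y \<in> insert x (t ` {0..m})" for y
    proof (cases "y = x")
      case True
      then show ?thesis using W0 by (simp add: E_def Q_def K_def)
    next
      case False
      then obtain l where "l \<le> m" "y = t l" using y by auto
      moreover from this have "poly W y = 0" by (auto simp: W)
      ultimately show ?thesis using poly_lagrange_poly[OF t(1)] by (simp add: E_def Q_def)
    qed
  qed (use t x in auto)
  then obtain \<xi> where \<xi>: "\<xi> \<in> {a..b}" "E (Suc m) \<xi> = 0" by auto
  \<comment> \<open>\<open>Q\<close> has degree at most \<open>Suc m\<close> and top coefficient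
    \<open>K\<close>, because \<open>W\<close> is monic and the interpolant has degree at most
    \<open>m\<close>; hence its derivative of order \<open>Suc m\<close> is constant.\<close>
  then have "D (Suc m) \<xi> = fact (Suc m) * K"
    using poly_higher_pderiv_degree[OF dQ, of \<xi>] cQ by (simp add: E_def del: funpow.simps)
  then have "\<bar>K\<bar> = \<bar>D (Suc m) \<xi>\<bar> / fact (Suc m)"
    by (simp add: abs_mult del: fact_Suc)
  also have "\<dots> \<le> B / fact (Suc m)"
    by (intro divide_right_mono B \<xi>) simp
  finally have "\<bar>K\<bar> * \<bar>poly W x\<bar> \<le> B / fact (Suc m) * \<bar>poly W x\<bar>"
    by (rule mult_right_mono) simp
  moreover have "D 0 x - poly (lagrange_poly t m (D 0)) x = K * poly W x"
    using W0 by (simp add: K_def)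
  ultimately show ?thesis by (simp add: abs_mult W)
qed

section \<open>Chebyshev polynomials and their zeros\<close>

text \<open>The Chebyshev polynomials of the first kind, by the three-term recurrence; as formal
  polynomials they have a degree and a leading coefficient to compare.\<close>

fun cheb_poly :: "nat \<Rightarrow> real poly" where
  "cheb_poly 0 = 1"
| "cheb_poly (Suc 0) = [:0, 1:]"
| "cheb_poly (Suc (Suc n)) = [:0, 2:] * cheb_poly (Suc n) - cheb_poly n"

lemma poly_cheb_poly_cos: "poly (cheb_poly n) (cos \<theta>) = cos (real n * \<theta>)"
proof (induction n rule: cheb_poly.induct)
  case (3 n)
  have "cos (real (Suc (Suc n)) * \<theta>) = cos (real (Suc n) * \<theta> + \<theta>)"
    "cos (real n * \<theta>) = cos (real (Suc n) * \<theta> - \<theta>)"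
    by (simp_all add: algebra_simps)
  then show ?case using 3 by (simp add: cos_add cos_diff)
qed auto

lemma degree_cheb_poly: "degree (cheb_poly n) \<le> n"
proof (induction n rule: cheb_poly.induct)
  case (3 n)
  have "degree ([:0, 2:] * cheb_poly (Suc n)) \<le> Suc (Suc n)"
    using 3(1) by (intro order_trans[OF degree_mult_le]) simp
  with 3(2) show ?case by (auto intro!: degree_diff_le)
qed auto

text \<open>Each recurrence step doubles the top coefficient, since the subtracted polynomial has
  degree lower by two. The index starts at \<open>Suc n\<close> because the doubling only begins at
  degree one.\<close>

lemma coeff_cheb_poly: "coeff (cheb_poly (Suc n)) (Suc n) = 2 ^ n"
proof (induction n rule: less_induct)
  case (less n)
  show ?case
  proof (cases n)
    case (Suc k)
    have "coeff (cheb_poly k) (Suc (Suc k)) = 0"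
      using degree_cheb_poly[of k] by (intro coeff_eq_0) simp
    then show ?thesis using Suc less[of k] by simp
  qed simp
qed

text \<open>The angles of the nodes lie in \<open>[0, pi]\<close>, where the cosine is
  injective.\<close>

lemma inj_on_cheb_node: "inj_on (cheb_node m) {0..m}"
proof (rule inj_onI)
  fix i k assume *: "i \<in> {0..m}" "k \<in> {0..m}" "cheb_node m i = cheb_node m k"
  define a where "a l = (2 * real l + 1) / (2 * real m + 2)" for l
  have node: "cheb_node m l = cos (a l * pi)" for l
    by (simp add: cheb_node_def a_def)
  have "0 \<le> a l" "a l \<le> 1" if "l \<in> {0..m}" for l
    using that by (simp_all add: a_def)
  then have r: "0 \<le> a l * pi" "a l * pi \<le> pi" if "l \<in> {0..m}" for l
    using that by (simp_all add: mult_left_le_one_le)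
  have "a i * pi = a k * pi"
    using *(3) unfolding node by (rule cos_inj_pi[OF r[OF *(1)] r[OF *(2)]])
  then show "i = k" by (simp add: a_def)
qed

text \<open>Multiplying the angle of a node by \<open>m + 1\<close> gives an odd multiple of
  \<open>pi / 2\<close>.\<close>

lemma poly_cheb_poly_node: "poly (cheb_poly (Suc m)) (cheb_node m i) = 0"
proof -
  have "real (Suc m) * ((2 * real i + 1) * pi / (2 * real m + 2)) = (2 * real i + 1) * (pi / 2)"
    by (simp add: divide_simps)
  moreover have "\<exists>k. odd k \<and> (2 * real i + 1) * (pi / 2) = real k * (pi / 2)"
    by (rule exI[of _ "2 * i + 1"]) simp
  ultimately show ?thesis
    unfolding cheb_node_def poly_cheb_poly_cos cos_zero_iff by simp
qed

text \<open>The nodal polynomial is \<open>cheb_poly (Suc m)\<close> divided by its leading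
  coefficient \<open>2 ^ m\<close>, and \<open>cheb_poly (Suc m)\<close> is a cosine on
  \<open>[-1, 1]\<close>.\<close>

lemma cheb_node_prod_bound:
  assumes "x \<in> {-1..1}"
  shows "\<bar>\<Prod>i=0..m. x - cheb_node m i\<bar> \<le> 1 / 2 ^ m"
proof -
  define W where "W = (\<Prod>i\<in>{0..m}. [:- cheb_node m i, 1:])"
  have "cheb_poly (Suc m) = smult (2 ^ m) W"
  \<comment> \<open>With equal coefficients at \<open>Suc m\<close> the difference has degree at
    most \<open>m\<close>, and it vanishes at \<open>m + 1\<close> distinct nodes.\<close>
  proof (rule poly_eqI_degree_lead_coeff[where n = "Suc m" and A = "cheb_node m ` {0..m}"])
    show "coeff (cheb_poly (Suc m)) (Suc m) = coeff (smult (2 ^ m) W) (Suc m)"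
      using coeff_prod_linear[of "cheb_node m" "{0..m}"] by (simp add: coeff_cheb_poly W_def)
    show "card (cheb_node m ` {0..m}) \<ge> Suc m"
      using card_image[OF inj_on_cheb_node] by simp
    show "degree (smult (2 ^ m) W) \<le> Suc m"
      by (simp add: W_def degree_prod_linear)
    show "poly (cheb_poly (Suc m)) z = poly (smult (2 ^ m) W) z" if "z \<in> cheb_node m ` {0..m}" for z
    proof -
      from that obtain i where "i \<le> m" "z = cheb_node m i" by auto
      then show ?thesis by (auto simp: W_def poly_prod poly_cheb_poly_node)
    qed
  qed (rule degree_cheb_poly)
  then have "poly (cheb_poly (Suc m)) (cos (arccos x)) = 2 ^ m * (\<Prod>i=0..m. x - cheb_node m i)"
    using assms by (simp add: W_def poly_prod)
  moreover have "\<bar>poly (cheb_poly (Suc m)) (cos (arccos x))\<bar> \<le> 1"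
    unfolding poly_cheb_poly_cos by simp
  ultimately show ?thesis by (simp add: abs_mult field_simps)
qed

lemma chebyshev_interpolation_error:
  fixes D :: "nat \<Rightarrow> real \<Rightarrow> real"
  assumes der: "\<And>i x. i \<le> m \<Longrightarrow> x \<in> {-1..1} \<Longrightarrow>
      (D i has_real_derivative D (Suc i) x) (at x within {-1..1})"
    and B: "\<And>x. x \<in> {-1..1} \<Longrightarrow> \<bar>D (Suc m) x\<bar> \<le> B"
    and x: "x \<in> {-1..1}"
  shows "\<bar>D 0 x - poly (lagrange_poly (cheb_node m) m (D 0)) x\<bar> \<le> B / (2 ^ m * fact (Suc m))"
proof -
  have "0 \<le> B" using B[OF x] by linarith
  have "\<bar>D 0 x - poly (lagrange_poly (cheb_node m) m (D 0)) x\<bar>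
      \<le> B / fact (Suc m) * \<bar>\<Prod>i=0..m. x - cheb_node m i\<bar>"
    by (rule lagrange_error[OF der inj_on_cheb_node _ B x]) (auto simp: cheb_node_def)
  also have "\<dots> \<le> B / fact (Suc m) * (1 / 2 ^ m)"
    using \<open>0 \<le> B\<close> by (intro mult_left_mono cheb_node_prod_bound x) simp
  finally show ?thesis by (simp add: mult.commute)
qed

subsection \<open>Localisation of the quadrature error\<close>

lemma nth_deriv_on_has_real_derivative:
  assumes "smooth_fun_on S f" "x \<in> S"
  shows "(nth_deriv_on S k f has_real_derivative nth_deriv_on S (Suc k) f x) (at x within S)"
  using assms
  by (simp add: smooth_fun_on_def differentiable_on_def vector_derivative_works
      has_real_derivative_iff_has_vector_derivative)

lemma continuous_on_nth_deriv_on: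
  assumes "smooth_fun_on S f"
  shows "continuous_on S (nth_deriv_on S k f)"
  using assms by (auto simp: smooth_fun_on_def intro: differentiable_imp_continuous_on)

lemma abs_nth_deriv_on_le_C_norm_on:
  assumes f: "smooth_fun_on S f" and S: "compact S" "x \<in> S" and k: "k \<le> N"
  shows "\<bar>nth_deriv_on S k f x\<bar> \<le> C_norm_on S N f"
proof -
  \<comment> \<open>The supremum in \<open>sup_norm_on\<close> bounds the values only once they are
    known to be bounded above; compactness provides this.\<close>
  have "compact ((\<lambda>x. \<bar>nth_deriv_on S k f x\<bar>) ` S)"
    using f S by (intro compact_continuous_image continuous_intros continuous_on_nth_deriv_on)
  then have "bdd_above ((\<lambda>x. \<bar>nth_deriv_on S k f x\<bar>) ` S)"
    by (intro bounded_imp_bdd_above compact_imp_bounded)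
  then have "\<bar>nth_deriv_on S k f x\<bar> \<le> sup_norm_on S (nth_deriv_on S k f)"
    unfolding sup_norm_on_def using S(2) by (intro cSUP_upper)
  also have "\<dots> \<le> C_norm_on S N f"
    unfolding C_norm_on_def using k by (intro Max_ge) auto
  finally show ?thesis .
qed

lemma integral_rescale_symmetric:
  fixes g :: "real \<Rightarrow> real"
  assumes "continuous_on {a..b} g" "a < b"
  shows "integral {a..b} g = integral {-1..1} (\<lambda>x. (b - a) / 2 * g ((b - a) / 2 * x + (a + b) / 2))"
proof -
  let ?s = "\<lambda>x. (b - a) / 2 * x + (a + b) / 2"
  have range: "?s x \<in> {a..b}" if "x \<in> {-1..1}" for x
  proof -
    have "(b - a) / 2 * x \<le> (b - a) / 2 * 1" "(b - a) / 2 * (-1) \<le> (b - a) / 2 * x"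
      using that assms(2) by (intro mult_left_mono; simp)+
    then show ?thesis by (simp add: field_simps)
  qed
  have ends: "?s (-1) = a" "?s 1 = b" by (simp_all add: field_simps)
  have "((\<lambda>x. ((b - a) / 2) *\<^sub>R g (?s x)) has_integral integral {?s (-1)..?s 1} g) {-1..1}"
  proof (rule has_integral_substitution)
    show "?s (-1) \<le> ?s 1" using assms(2) unfolding ends by simp
    show "(?s has_real_derivative (b - a) / 2) (at x within {-1..1})" for x
      by (auto intro!: derivative_eq_intros)
  qed (use assms range in auto)
  then show ?thesis unfolding ends real_scaleR_def by (rule integral_unique[symmetric])
qed

section \<open>The graded mesh and the splitting of the integral\<close>

context
  fixes \<alpha> :: real and n :: nat
  assumes \<alpha>: "\<alpha> > 1" and n: "n > 1"
begin

lemma mesh_end: "mesh \<alpha> n n = 1"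
  using \<alpha> n by (simp add: mesh_def)

lemma mesh_less_Suc: "mesh \<alpha> n j < mesh \<alpha> n (Suc j)"
  using \<alpha> n by (simp add: mesh_def divide_strict_right_mono)

lemma mesh_nonneg: "0 \<le> mesh \<alpha> n j"
  by (simp add: mesh_def)

lemma mesh_mono: "i \<le> j \<Longrightarrow> mesh \<alpha> n i \<le> mesh \<alpha> n j"
  by (rule lift_Suc_mono_le[of "mesh \<alpha> n"]) (simp_all add: less_imp_le[OF mesh_less_Suc])

lemma mesh_step_pos: "j \<ge> 1 \<Longrightarrow> mesh_step \<alpha> n j > 0"
  using mesh_less_Suc[of "j - 1"] by (simp add: mesh_step_def)

lemma loc_point_mem:
  assumes "1 \<le> j" "j \<le> n" "x \<in> {-1..1}"
  shows "mesh_step \<alpha> n j / 2 * x + (mesh \<alpha> n (j - 1) + mesh \<alpha> n j) / 2 \<in> {0..1}"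
proof -
  let ?h = "mesh_step \<alpha> n j"
  have "?h / 2 * x \<le> ?h / 2 * 1" "?h / 2 * (-1) \<le> ?h / 2 * x"
    using assms mesh_step_pos[of j] by (intro mult_left_mono; simp)+
  then show ?thesis
    using mesh_nonneg[of "j - 1"] mesh_mono[OF assms(2)] mesh_end
    by (simp add: mesh_step_def field_simps)
qed

text \<open>\<open>loc_alpha\<close> and \<open>loc_beta\<close> are exactly the parameters that the
  Gaussian acquires under the affine map from \<open>[-1, 1]\<close> onto the subinterval.\<close>

lemma gauss_loc:
  assumes "1 \<le> j"
  shows "gauss (loc_alpha \<alpha> n j) (loc_beta \<alpha> n j) x =
    gauss \<alpha> 0 (mesh_step \<alpha> n j / 2 * x + (mesh \<alpha> n (j - 1) + mesh \<alpha> n j) / 2)"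
proof -
  have eq: "\<alpha> * h / 2 * (x - - s / h) = \<alpha> * (h / 2 * x + s / 2)" if "h \<noteq> 0" for h s :: real
    using that by (simp add: field_simps)
  have "mesh_step \<alpha> n j \<noteq> 0" using mesh_step_pos[OF assms] by simp
  then show ?thesis
    unfolding gauss_def loc_alpha_def loc_beta_def power_mult_distrib[symmetric] diff_zero
    by (subst eq) simp_all
qed

text \<open>Additivity along the mesh, then an affine substitution on each piece. It serves both for
  \<open>f\<close> and for the constant one, whose local integrals are the Gaussian masses of the
  subintervals.\<close>

lemma gauss_int_eq_sum_local:
  assumes "continuous_on {0..1} g"
  shows "gauss_int \<alpha> g =
    (\<Sum>j=1..n. gauss_int_shift (loc_alpha \<alpha> n j) (loc_beta \<alpha> n j) (loc_fun \<alpha> n j g))"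
proof -
  let ?F = "\<lambda>x. g x * gauss \<alpha> 0 x"
  have cont: "continuous_on {0..1} ?F"
    unfolding gauss_def by (intro continuous_intros assms)
  have partial: "integral {0..mesh \<alpha> n k} ?F = (\<Sum>j=1..k. integral {mesh \<alpha> n (j - 1)..mesh \<alpha> n j} ?F)"
    if "k \<le> n" for k
    using that
  proof (induction k)
    case 0
    then show ?case by (simp add: mesh_def)
  next
    case (Suc k)
    have "integral {0..mesh \<alpha> n k} ?F + integral {mesh \<alpha> n k..mesh \<alpha> n (Suc k)} ?F
        = integral {0..mesh \<alpha> n (Suc k)} ?F"
    proof (rule Henstock_Kurzweil_Integration.integral_combine)
      have "mesh \<alpha> n (Suc k) \<le> 1" using mesh_mono[OF Suc.prems] mesh_end by simp
      then show "?F integrable_on {0..mesh \<alpha> n (Suc k)}"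
        by (intro integrable_continuous_real continuous_on_subset[OF cont]) auto
    qed (use mesh_nonneg mesh_less_Suc less_imp_le in auto)
    with Suc show ?case by simp
  qed
  have loc: "integral {mesh \<alpha> n (j - 1)..mesh \<alpha> n j} ?F
      = gauss_int_shift (loc_alpha \<alpha> n j) (loc_beta \<alpha> n j) (loc_fun \<alpha> n j g)"
    if j: "j \<in> {1..n}" for j
  proof -
    have j': "1 \<le> j" "j \<le> n" using j by auto
    have sub: "{mesh \<alpha> n (j - 1)..mesh \<alpha> n j} \<subseteq> {0..1}"
      using mesh_nonneg[of "j - 1"] mesh_mono[OF j'(2)] mesh_end by auto
    have lt: "mesh \<alpha> n (j - 1) < mesh \<alpha> n j"
      using mesh_step_pos[OF j'(1)] by (simp add: mesh_step_def)
    show ?thesis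
      unfolding integral_rescale_symmetric[OF continuous_on_subset[OF cont sub] lt]
        gauss_int_shift_def gauss_loc[OF j'(1)] loc_fun_def
      by (simp add: mesh_step_def mult.assoc)
  qed
  have "gauss_int \<alpha> g = integral {0..mesh \<alpha> n n} ?F"
    by (simp add: gauss_int_def mesh_end)
  also have "\<dots> = (\<Sum>j=1..n. integral {mesh \<alpha> n (j - 1)..mesh \<alpha> n j} ?F)"
    by (rule partial) simp
  also have "\<dots> = (\<Sum>j=1..n. gauss_int_shift (loc_alpha \<alpha> n j) (loc_beta \<alpha> n j) (loc_fun \<alpha> n j g))"
    by (intro sum.cong loc refl)
  finally show ?thesis .
qed

text \<open>A completed square bounds the Gaussian by a decaying exponential with an elementary
  antiderivative.\<close>

lemma gauss_int_one_le: "gauss_int \<alpha> (\<lambda>_. 1) \<le> 2 / \<alpha>"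
proof -
  have le: "gauss \<alpha> 0 x \<le> 2 * exp (- (\<alpha> * x))" for x
  proof -
    have "0 \<le> (\<alpha> * x - 1 / 2)\<^sup>2" by simp
    \<comment> \<open>The square gives even \<open>1 / 4\<close>; the weaker \<open>1 / 2\<close> is
      the argument at which \<open>exp\<close> is bounded by 2 below.\<close>
    then have "- (\<alpha>\<^sup>2 * x\<^sup>2) \<le> 1 / 2 - \<alpha> * x" by (simp add: power2_eq_square algebra_simps)
    then have "gauss \<alpha> 0 x \<le> exp (1 / 2) * exp (- (\<alpha> * x))"
      by (simp add: gauss_def flip: exp_add)
    also have "\<dots> \<le> 2 * exp (- (\<alpha> * x))"
      using exp_bound_half[of "1 / 2 :: real"] by (intro mult_right_mono) auto
    finally show ?thesis .
  qed
  let ?P = "\<lambda>x. - 2 / \<alpha> * exp (- (\<alpha> * x))"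
  have "((\<lambda>x. 2 * exp (- (\<alpha> * x))) has_integral ?P 1 - ?P 0) {0..1}"
    using \<alpha> by (intro fundamental_theorem_of_calculus)
      (auto intro!: derivative_eq_intros simp flip: has_real_derivative_iff_has_vector_derivative)
  moreover have "(gauss \<alpha> 0 has_integral gauss_int \<alpha> (\<lambda>_. 1)) {0..1}"
    unfolding gauss_int_def gauss_def
    by (simp, intro integrable_integral integrable_continuous_real continuous_intros)
  ultimately have "gauss_int \<alpha> (\<lambda>_. 1) \<le> ?P 1 - ?P 0"
    using le has_integral_le by blast
  also have "\<dots> \<le> 2 / \<alpha>" using \<alpha> by simp
  finally show ?thesis .
qed

text \<open>\<open>B\<close> is measured relative to \<open>mesh_step / 2\<close>, the factor built
  into \<open>loc_fun\<close>. Each local error is then at most \<open>B\<close> times a local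
  Gaussian mass, and the masses add up without a factor \<open>n\<close>.\<close>

lemma comp_quad_error_le:
  assumes f: "continuous_on {0..1} f"
    and B: "\<And>j x. j \<in> {1..n} \<Longrightarrow> x \<in> {-1..1} \<Longrightarrow>
      \<bar>loc_fun \<alpha> n j f x
        - poly (lagrange_poly (cheb_node (loc_degree n j)) (loc_degree n j) (loc_fun \<alpha> n j f)) x\<bar>
      \<le> mesh_step \<alpha> n j / 2 * B"
    and "0 \<le> B"
  shows "comp_quad_error \<alpha> n f \<le> B * (2 / \<alpha>)"
proof -
  let ?p = "\<lambda>j. poly (lagrange_poly (cheb_node (loc_degree n j)) (loc_degree n j) (loc_fun \<alpha> n j f))"
  let ?G = "\<lambda>j. gauss (loc_alpha \<alpha> n j) (loc_beta \<alpha> n j)"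
  let ?I = "\<lambda>j. gauss_int_shift (loc_alpha \<alpha> n j) (loc_beta \<alpha> n j)"
  have contG: "continuous_on A (?G j)" for A j
    unfolding gauss_def by (intro continuous_intros)
  have contf: "continuous_on {-1..1} (loc_fun \<alpha> n j f)" if "j \<in> {1..n}" for j
  proof -
    have "(\<lambda>x. mesh_step \<alpha> n j / 2 * x + (mesh \<alpha> n (j - 1) + mesh \<alpha> n j) / 2) ` {-1..1} \<subseteq> {0..1}"
      using that by (intro image_subsetI loc_point_mem) simp_all
    then show ?thesis
      unfolding loc_fun_def
      by (intro continuous_on_mult continuous_on_const continuous_on_compose2[OF f]
          continuous_on_add continuous_on_id)
  qed
  have contp: "continuous_on A (?p j)" for A j
    by (intro continuous_on_poly continuous_on_id)
  have loc: "\<bar>?I j (loc_fun \<alpha> n j f) - ?I j (?p j)\<bar> \<le> B * ?I j (loc_fun \<alpha> n j (\<lambda>_. 1))"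
    if j: "j \<in> {1..n}" for j
  proof -
    have diff: "?I j (loc_fun \<alpha> n j f) - ?I j (?p j)
        = integral {-1..1} (\<lambda>x. loc_fun \<alpha> n j f x * ?G j x - ?p j x * ?G j x)"
      unfolding gauss_int_shift_def
      by (rule Henstock_Kurzweil_Integration.integral_diff[symmetric])
        (intro integrable_continuous_real continuous_on_mult contG contf[OF j] contp)+
    have bound: "\<bar>integral {-1..1} (\<lambda>x. loc_fun \<alpha> n j f x * ?G j x - ?p j x * ?G j x)\<bar>
        \<le> integral {-1..1} (\<lambda>x. B * (mesh_step \<alpha> n j / 2 * ?G j x))"
    proof -
      have le: "\<bar>loc_fun \<alpha> n j f x * ?G j x - ?p j x * ?G j x\<bar> \<le> B * (mesh_step \<alpha> n j / 2 * ?G j x)"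
        if "x \<in> {-1..1}" for x
      proof -
        have "\<bar>loc_fun \<alpha> n j f x - ?p j x\<bar> * ?G j x \<le> mesh_step \<alpha> n j / 2 * B * ?G j x"
          by (intro mult_right_mono B j that) (simp add: gauss_def)
        moreover have "\<bar>?G j x\<bar> = ?G j x" by (simp add: gauss_def)
        ultimately show ?thesis
          unfolding left_diff_distrib[symmetric] abs_mult by (simp only: mult_ac)
      qed
      have "(\<lambda>x. loc_fun \<alpha> n j f x * ?G j x - ?p j x * ?G j x) integrable_on {-1..1}"
        by (intro integrable_continuous_real continuous_on_diff continuous_on_mult contG contf[OF j] contp)
      moreover have "(\<lambda>x. B * (mesh_step \<alpha> n j / 2 * ?G j x)) integrable_on {-1..1}"
        by (intro integrable_continuous_real continuous_on_mult continuous_on_const contG)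
      ultimately have "norm (integral {-1..1} (\<lambda>x. loc_fun \<alpha> n j f x * ?G j x - ?p j x * ?G j x))
          \<le> integral {-1..1} (\<lambda>x. B * (mesh_step \<alpha> n j / 2 * ?G j x))"
        by (rule integral_norm_bound_integral) (unfold real_norm_def, rule le)
      then show ?thesis unfolding real_norm_def .
    qed
    have "integral {-1..1} (\<lambda>x. B * (mesh_step \<alpha> n j / 2 * ?G j x)) = B * ?I j (loc_fun \<alpha> n j (\<lambda>_. 1))"
      unfolding gauss_int_shift_def loc_fun_def mult_1_right by (rule integral_mult_right)
    then show ?thesis using bound unfolding diff by (rule subst)
  qed
  have "comp_quad_error \<alpha> n f = \<bar>\<Sum>j=1..n. ?I j (loc_fun \<alpha> n j f) - ?I j (?p j)\<bar>"
    unfolding comp_quad_error_def comp_quad_def basic_quad_def gauss_int_eq_sum_local[OF f]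
      sum_subtractf ..
  also have "\<dots> \<le> (\<Sum>j=1..n. \<bar>?I j (loc_fun \<alpha> n j f) - ?I j (?p j)\<bar>)"
    by (rule sum_abs)
  also have "\<dots> \<le> (\<Sum>j=1..n. B * ?I j (loc_fun \<alpha> n j (\<lambda>_. 1)))"
    by (intro sum_mono loc)
  \<comment> \<open>The splitting is read backwards, for the constant function one.\<close>
  also have "\<dots> = B * gauss_int \<alpha> (\<lambda>_. 1)"
    unfolding gauss_int_eq_sum_local[OF continuous_on_const] sum_distrib_left ..
  also have "\<dots> \<le> B * (2 / \<alpha>)"
    by (intro mult_left_mono gauss_int_one_le assms)
  finally show ?thesis .
qed

text \<open>By the chain rule every derivative of \<open>loc_fun\<close> brings out half the step;
  the half step from the substitution is kept in front, as \<open>comp_quad_error_le\<close>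
  expects. A free \<open>N\<close> lets one norm serve all degrees.\<close>

lemma loc_fun_interpolation_error:
  assumes f: "smooth_fun_on {0..1} f" and j: "1 \<le> j" "j \<le> n" and N: "Suc m \<le> N"
    and x: "x \<in> {-1..1}"
  shows "\<bar>loc_fun \<alpha> n j f x - poly (lagrange_poly (cheb_node m) m (loc_fun \<alpha> n j f)) x\<bar>
    \<le> mesh_step \<alpha> n j / 2 *
      ((mesh_step \<alpha> n j / 2) ^ Suc m / (2 ^ m * fact (Suc m)) * C_norm_on {0..1} N f)"
proof -
  define h where "h = mesh_step \<alpha> n j / 2"
  define s where "s x = h * x + (mesh \<alpha> n (j - 1) + mesh \<alpha> n j) / 2" for x
  \<comment> \<open>The exponent is \<open>Suc i\<close>, not \<open>i\<close>, because
    \<open>loc_fun\<close> itself carries a factor \<open>h\<close>.\<close>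
  define D where "D i x = h ^ Suc i * nth_deriv_on {0..1} i f (s x)" for i x
  have h: "h > 0" using mesh_step_pos[OF j(1)] by (simp add: h_def)
  have s: "s x \<in> {0..1}" if "x \<in> {-1..1}" for x
    using loc_point_mem[OF j that] by (simp add: s_def h_def)
  have D0: "D 0 = loc_fun \<alpha> n j f"
    by (rule ext) (simp add: D_def s_def h_def loc_fun_def)
  have "\<bar>D 0 x - poly (lagrange_poly (cheb_node m) m (D 0)) x\<bar>
      \<le> h ^ Suc (Suc m) * C_norm_on {0..1} N f / (2 ^ m * fact (Suc m))"
  proof (rule chebyshev_interpolation_error[OF _ _ x])
    show "(D i has_real_derivative D (Suc i) y) (at y within {-1..1})" if y: "y \<in> {-1..1}" for i y
    proof -
      have "(nth_deriv_on {0..1} i f has_real_derivative nth_deriv_on {0..1} (Suc i) f (s y))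
          (at (s y) within s ` {-1..1})"
        using s by (intro DERIV_subset[OF nth_deriv_on_has_real_derivative[OF f s[OF y]]]) auto
      moreover have "(s has_real_derivative h) (at y within {-1..1})"
        unfolding s_def by (auto intro!: derivative_eq_intros)
      ultimately have "(nth_deriv_on {0..1} i f \<circ> s has_real_derivative
          nth_deriv_on {0..1} (Suc i) f (s y) * h) (at y within {-1..1})"
        by (rule DERIV_image_chain)
      from DERIV_cmult[OF this, of "h ^ Suc i"]
      have "(D i has_real_derivative h ^ Suc i * (nth_deriv_on {0..1} (Suc i) f (s y) * h))
          (at y within {-1..1})"
        unfolding D_def[abs_def] comp_def .
      moreover have "h ^ Suc i * (nth_deriv_on {0..1} (Suc i) f (s y) * h) = D (Suc i) y"
        unfolding D_def power_Suc2[of h "Suc i"] by (simp only: mult_ac)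
      ultimately show ?thesis by simp
    qed
    show "\<bar>D (Suc m) y\<bar> \<le> h ^ Suc (Suc m) * C_norm_on {0..1} N f" if "y \<in> {-1..1}" for y
    proof -
      have "\<bar>nth_deriv_on {0..1} (Suc m) f (s y)\<bar> \<le> C_norm_on {0..1} N f"
        using s[OF that] by (intro abs_nth_deriv_on_le_C_norm_on f N) simp_all
      then have "h ^ Suc (Suc m) * \<bar>nth_deriv_on {0..1} (Suc m) f (s y)\<bar>
          \<le> h ^ Suc (Suc m) * C_norm_on {0..1} N f"
        using h by (intro mult_left_mono) simp_all
      then show ?thesis
        unfolding D_def abs_mult power_abs using h by (simp only: abs_of_pos)
    qed
  qed
  also have "\<dots> = h * (h ^ Suc m / (2 ^ m * fact (Suc m)) * C_norm_on {0..1} N f)"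
    by (simp only: power_Suc[of h "Suc m"] times_divide_eq_left times_divide_eq_right mult.assoc)
  finally show ?thesis unfolding D0 h_def .
qed

end

subsection \<open>Estimates on the graded mesh\<close>

text \<open>A single term of the exponential series, whose terms are all nonnegative here.\<close>

lemma power_le_fact_times_exp:
  assumes "0 \<le> (x::real)"
  shows "x ^ k \<le> fact k * exp x"
proof -
  have "(\<Sum>i\<in>{k}. x ^ i /\<^sub>R fact i) \<le> (\<Sum>i. x ^ i /\<^sub>R fact i)"
    using assms by (intro sum_le_suminf summable_exp_generic) auto
  then have "x ^ k / fact k \<le> exp x" by (simp add: exp_def divide_inverse mult.commute)
  then show ?thesis by (simp add: field_simps)
qed

text \<open>A weak form of Stirling's lower bound, from the exponential series at
  \<open>x = k\<close>.\<close>

lemma power_div_exp_le_fact: "(real k / exp 1) ^ k \<le> fact k"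
  using power_le_fact_times_exp[of "real k" k]
  by (simp add: power_divide divide_le_eq exp_of_nat_mult[symmetric])

text \<open>Turns a spare power of two into the algebraic factor of the error bound.\<close>

lemma inverse_two_power_le: "1 / 2 ^ n \<le> (real n + 1) powr (- 1 / 2)"
proof -
  have "real (n + 1) \<le> 2 ^ n" by (induction n) auto
  have "(real n + 1) powr (1 / 2) \<le> (real n + 1) powr 1"
    by (intro powr_mono) auto
  then have "(real n + 1) powr (1 / 2) \<le> 2 ^ n" using \<open>real (n + 1) \<le> 2 ^ n\<close> by simp
  then have "1 / 2 ^ n \<le> 1 / (real n + 1) powr (1 / 2)"
    by (intro divide_left_mono) auto
  then show ?thesis by (simp add: powr_minus_divide)
qed

lemma loc_degree_ge:
  assumes "1 \<le> j" "j \<le> n"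
  shows "real n * (real n - 1) \<le> real (loc_degree n j) * (real n + 1 - real j)"
proof -
  have "real n * (real n - 1) / (real n + 1 - real j) \<le> real (loc_degree n j)"
    unfolding loc_degree_def by linarith
  then show ?thesis using assms by (simp add: divide_le_eq)
qed

text \<open>The degree is largest at \<open>j = n\<close>, where the denominator is 1; one more
  derivative gives the order of the norm in the theorem.\<close>

lemma loc_degree_le:
  assumes "1 \<le> j" "j \<le> n"
  shows "loc_degree n j \<le> (n - 1) * n"
proof -
  have "real n * (real n - 1) / (real n + 1 - real j) \<le> real n * (real n - 1) / 1"
    using assms by (intro divide_left_mono) auto
  also have "\<dots> = real ((n - 1) * n)" using assms by (simp add: of_nat_diff)
  finally show ?thesis unfolding loc_degree_def by linarith
qed

lemma loc_degree_1: "n \<ge> 1 \<Longrightarrow> loc_degree n 1 = n - 1"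
  by (simp add: loc_degree_def of_nat_diff)

text \<open>The first subinterval has length \<open>1 / \<alpha>\<close> and degree only
  \<open>n - 1\<close>, whereas later degrees are at least \<open>n\<close>. Two powers of two are
  thus missing, whence the factor 4.\<close>

lemma local_error_factor_first:
  assumes "\<alpha> > 1" "n > 1"
  shows "(mesh_step \<alpha> n 1 / 2) ^ Suc (loc_degree n 1) / (2 ^ loc_degree n 1 * fact (Suc (loc_degree n 1)))
    \<le> 4 * (real n + 1) powr (- 1 / 2) / (2 ^ (n + 1) * \<alpha> ^ n)"
proof -
  have h: "mesh_step \<alpha> n 1 = 1 / \<alpha>"
    using assms by (simp add: mesh_step_def mesh_def powr_minus_divide)
  have "loc_degree n 1 = n - 1" using loc_degree_1 assms by simp
  moreover obtain k where k: "n = Suc k" using assms by (cases n) auto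
  ultimately have "(mesh_step \<alpha> n 1 / 2) ^ Suc (loc_degree n 1)
      / (2 ^ loc_degree n 1 * fact (Suc (loc_degree n 1)))
    = 4 * (1 / 2 ^ n / fact n) / (2 ^ (n + 1) * \<alpha> ^ n)"
    unfolding h by (simp add: power_divide del: fact_Suc)
  also have "1 / 2 ^ n / fact n \<le> 1 / 2 ^ n / (1 :: real)"
    by (intro divide_left_mono) auto
  also have "\<dots> \<le> (real n + 1) powr (- 1 / 2)" using inverse_two_power_le by simp
  finally show ?thesis using assms by (simp add: divide_right_mono mult_left_mono)
qed

text \<open>The numerator power of \<open>\<theta> - 1\<close> is beaten by the factorial, the
  denominator power of \<open>\<theta>\<close> yields \<open>\<alpha> ^ n\<close>, and the powers of
  two supply \<open>2 ^ (n + 1)\<close> with \<open>2 ^ n\<close> to spare.\<close>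

lemma local_error_factor_later:
  assumes \<alpha>: "\<alpha> > 1" and n: "n > 1" and j: "2 \<le> j" "j \<le> n"
    and cond: "(real n - 1) * (ln (real n + 1 + exp 1) - 1) \<ge> ln \<alpha>"
  defines "m \<equiv> loc_degree n j"
  shows "(mesh_step \<alpha> n j / 2) ^ Suc m / (2 ^ m * fact (Suc m))
    \<le> (real n + 1) powr (- 1 / 2) / (2 ^ (n + 1) * \<alpha> ^ n)"
proof -
  \<comment> \<open>The constant ratio of consecutive positive mesh points.\<close>
  define \<theta> where "\<theta> = \<alpha> powr (1 / (real n - 1))"
  define k where "k = n + 1 - j"
  have k: "real k = real n + 1 - real j" "1 \<le> k" "k \<le> n - 1"
    using j n by (auto simp: k_def of_nat_diff)
  have \<theta>1: "1 < \<theta>" using \<alpha> n by (simp add: \<theta>_def)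
  have \<alpha>\<theta>: "\<alpha> = \<theta> powr (real n - 1)" using \<alpha> n by (simp add: \<theta>_def powr_powr)
  have m: "n * (n - 1) \<le> m * k"
  proof -
    have "real (n * (n - 1)) \<le> real (m * k)"
      using loc_degree_ge[of j n] j n k by (simp add: m_def of_nat_diff)
    then show ?thesis by linarith
  qed
  \<comment> \<open>Here \<open>j \<ge> 2\<close> enters through \<open>k \<le> n - 1\<close>;
    cancelling \<open>n - 1\<close> gives \<open>n \<le> m\<close>.\<close>
  have "n * (n - 1) \<le> m * (n - 1)"
    using m mult_le_mono2[OF k(3), of m] by linarith
  then have mn: "n \<le> m" using n by simp
  have "mesh_step \<alpha> n j = \<theta> powr (real j - real n) - \<theta> powr (real j - 1 - real n)"
  proof -
    have "(real j - 1) / (real n - 1) - 1 = 1 / (real n - 1) * (real j - real n)"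
      "(real j - 1 - 1) / (real n - 1) - 1 = 1 / (real n - 1) * (real j - 1 - real n)"
      using n by (simp_all add: field_simps)
    then show ?thesis using j by (simp add: mesh_step_def mesh_def \<theta>_def powr_powr of_nat_diff)
  qed
  also have "\<dots> = \<theta> powr (- real k) * (\<theta> - 1)"
  proof -
    have "\<theta> powr (real j - real n) = \<theta> powr (- real k + 1)"
      "\<theta> powr (real j - 1 - real n) = \<theta> powr (- real k)"
      by (simp_all add: k algebra_simps)
    then show ?thesis using \<theta>1 by (simp only: powr_add) (simp add: algebra_simps)
  qed
  finally have h: "mesh_step \<alpha> n j = (\<theta> - 1) / \<theta> ^ k"
    using \<theta>1 by (simp add: powr_minus_divide powr_realpow)
  \<comment> \<open>The condition divided by \<open>n - 1\<close> bounds \<open>ln \<theta>\<close>.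
    After exponentiation the summand \<open>exp 1\<close> contributes exactly the 1 that is
    subtracted in \<open>\<theta> - 1\<close>.\<close>
  have "\<theta> \<le> exp (ln (real n + 1 + exp 1) - 1)"
  proof -
    have "ln \<theta> = ln \<alpha> / (real n - 1)" using \<alpha> by (simp add: \<theta>_def ln_powr)
    also have "\<dots> \<le> ln (real n + 1 + exp 1) - 1"
      using cond n by (simp add: divide_le_eq mult.commute)
    finally have "exp (ln \<theta>) \<le> exp (ln (real n + 1 + exp 1) - 1)" by simp
    then show ?thesis using \<theta>1 by simp
  qed
  also have "\<dots> = (real n + 1 + exp 1) / exp 1"
    by (subst exp_diff, subst exp_ln) (auto intro: add_pos_pos)
  finally have "\<theta> - 1 \<le> (real n + 1) / exp 1" by (simp add: add_divide_distrib)
  \<comment> \<open>Matches the base to the exponent \<open>Suc m\<close> for the Stirling-type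
    bound.\<close>
  also have "\<dots> \<le> real (Suc m) / exp 1" using mn by (intro divide_right_mono) auto
  finally have "(\<theta> - 1) ^ Suc m \<le> (real (Suc m) / exp 1) ^ Suc m"
    using \<theta>1 by (intro power_mono) auto
  also have "\<dots> \<le> fact (Suc m)" by (rule power_div_exp_le_fact)
  finally have num: "(\<theta> - 1) ^ Suc m / fact (Suc m) \<le> 1" by simp
  have "\<alpha> = \<theta> ^ (n - 1)"
    using \<alpha>\<theta> \<theta>1 n by (simp add: of_nat_diff flip: powr_realpow)
  then have "\<alpha> ^ n = \<theta> ^ (n * (n - 1))" by (simp add: mult.commute flip: power_mult)
  also have "\<dots> \<le> \<theta> ^ (k * Suc m)"
    using m \<theta>1 by (intro power_increasing) (auto simp: mult.commute)
  finally have den: "\<alpha> ^ n \<le> \<theta> ^ (k * Suc m)" .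
  \<comment> \<open>Of the powers of two, \<open>2 ^ Suc m\<close> comes from halving the step and
    \<open>2 ^ m\<close> from the Chebyshev nodes.\<close>
  have "(mesh_step \<alpha> n j / 2) ^ Suc m / (2 ^ m * fact (Suc m))
      = (\<theta> - 1) ^ Suc m / fact (Suc m) / (2 ^ Suc m * 2 ^ m * \<theta> ^ (k * Suc m))"
    unfolding h power_divide power_mult by (simp del: fact_Suc power_Suc)
  also have "\<dots> \<le> 1 / (2 ^ Suc m * 2 ^ m * \<theta> ^ (k * Suc m))"
    using num \<theta>1 by (intro divide_right_mono) auto
  also have "\<dots> \<le> 1 / (2 ^ (n + 1) * 2 ^ n * \<alpha> ^ n)"
  proof -
    have "(2 ^ (n + 1) * 2 ^ n * \<alpha> ^ n) \<le> 2 ^ Suc m * 2 ^ m * \<theta> ^ (k * Suc m)"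
      using mn den \<alpha> by (intro mult_mono power_increasing) auto
    then show ?thesis using \<alpha> \<theta>1 by (intro divide_left_mono) auto
  qed
  also have "\<dots> = 1 / 2 ^ n / (2 ^ (n + 1) * \<alpha> ^ n)" by simp
  also have "\<dots> \<le> (real n + 1) powr (- 1 / 2) / (2 ^ (n + 1) * \<alpha> ^ n)"
    using inverse_two_power_le \<alpha> by (intro divide_right_mono) auto
  finally show ?thesis .
qed

section \<open>The number of nodes\<close>

text \<open>\<open>harm n - ln n\<close> is decreasing and equals 1 at \<open>n = 1\<close>.\<close>

lemma harm_le_one_plus_ln:
  assumes "n \<ge> 1"
  shows "harm n \<le> 1 + ln (real n)"
proof -
  obtain k where k: "n = Suc k" using assms by (cases n) auto
  have "harm (Suc k) - ln (real (Suc k)) \<le> harm (Suc 0) - ln (real (Suc 0))"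
    using decseqD[OF decseq_harm_diff_ln, of 0 k] by simp
  then show ?thesis by (simp add: k harm_expand)
qed

text \<open>Read in reverse order, the denominators \<open>n + 1 - j\<close> run through
  \<open>1..n\<close>, so the degrees sum to a multiple of a harmonic number up to rounding.\<close>

lemma comp_quad_nodes_le:
  assumes "n \<ge> 1"
  shows "real (comp_quad_nodes n) \<le> real n * (real n - 1) * ln (real n) + (real n)\<^sup>2 + real n"
proof -
  have "real (comp_quad_nodes n)
      \<le> (\<Sum>j=1..n. real n * (real n - 1) * inverse (real (Suc n - j)) + 2)"
    unfolding comp_quad_nodes_def of_nat_sum
  proof (intro sum_mono)
    fix j assume j: "j \<in> {1..n}"
    have "0 \<le> real n * (real n - 1) / (real n + 1 - real j)"
      using j by (intro divide_nonneg_nonneg mult_nonneg_nonneg) auto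
    then have "real (loc_degree n j) \<le> real n * (real n - 1) / (real n + 1 - real j) + 1"
      unfolding loc_degree_def by linarith
    \<comment> \<open>The 2 is one for the ceiling and one for the extra node of a formula of degree
      \<open>m\<close>.\<close>
    then show "real (loc_degree n j + 1) \<le> real n * (real n - 1) * inverse (real (Suc n - j)) + 2"
      using j by (simp add: of_nat_diff divide_inverse add_ac)
  qed
  also have "\<dots> = real n * (real n - 1) * (\<Sum>j=1..n. inverse (real (Suc n - j))) + 2 * real n"
    by (simp add: sum.distrib sum_distrib_left)
  also have "(\<Sum>j=1..n. inverse (real (Suc n - j))) = harm n"
    unfolding harm_def by (rule sum.reindex_bij_witness[of _ "\<lambda>i. Suc n - i" "\<lambda>i. Suc n - i"]) auto
  also have "real n * (real n - 1) * harm n + 2 * real n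
      \<le> real n * (real n - 1) * (1 + ln (real n)) + 2 * real n"
    using assms harm_le_one_plus_ln by (intro add_right_mono mult_left_mono) auto
  also have "\<dots> = real n * (real n - 1) * ln (real n) + (real n)\<^sup>2 + real n"
    by (simp add: algebra_simps power2_eq_square)
  finally show ?thesis .
qed

section \<open>Assembly of the error bound\<close>

text \<open>The constant 8 is the 4 of the first subinterval times the 2 in the Gaussian mass
  \<open>2 / \<alpha>\<close>.\<close>

lemma comp_quad_error_bound:
  assumes f: "smooth_fun_on {0..1} f" and \<alpha>: "\<alpha> > 1" and n: "n > 1"
    and cond: "(real n - 1) * (ln (real n + 1 + exp 1) - 1) \<ge> ln \<alpha>"
  shows "comp_quad_error \<alpha> n f
    \<le> 8 * (real n + 1) powr (- 1 / 2) * (2 * \<alpha>) powr (- real n - 1)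
        * C_norm_on {0..1} ((n - 1) * n + 1) f"
proof -
  define C where "C = C_norm_on {0..1} ((n - 1) * n + 1) f"
  define R where "R = (real n + 1) powr (- 1 / 2) / (2 ^ (n + 1) * \<alpha> ^ n)"
  have "\<bar>nth_deriv_on {0..1} 0 f 0\<bar> \<le> C"
    unfolding C_def by (rule abs_nth_deriv_on_le_C_norm_on[OF f]) auto
  then have C: "0 \<le> C" by linarith
  have R: "0 \<le> R" using \<alpha> by (simp add: R_def)
  have factor: "(mesh_step \<alpha> n j / 2) ^ Suc (loc_degree n j)
      / (2 ^ loc_degree n j * fact (Suc (loc_degree n j))) \<le> 4 * R" if "j \<in> {1..n}" for j
  proof (cases "j = 1")
    case True
    then show ?thesis using local_error_factor_first[OF \<alpha> n] by (simp only: R_def times_divide_eq_right)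
  next
    case False
    then have "2 \<le> j" "j \<le> n" using that by auto
    from local_error_factor_later[OF \<alpha> n this cond] R show ?thesis unfolding R_def by linarith
  qed
  have err: "comp_quad_error \<alpha> n f \<le> 4 * R * C * (2 / \<alpha>)"
  proof (rule comp_quad_error_le[OF \<alpha> n])
    show "continuous_on {0..1} f"
      using continuous_on_nth_deriv_on[OF f, of 0] by simp
    show "0 \<le> 4 * R * C" using R C by simp
    fix j x assume j: "j \<in> {1..n}" and x: "x \<in> {-1..1::real}"
    have "\<bar>loc_fun \<alpha> n j f x
        - poly (lagrange_poly (cheb_node (loc_degree n j)) (loc_degree n j) (loc_fun \<alpha> n j f)) x\<bar>
      \<le> mesh_step \<alpha> n j / 2 * ((mesh_step \<alpha> n j / 2) ^ Suc (loc_degree n j)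
          / (2 ^ loc_degree n j * fact (Suc (loc_degree n j))) * C)"
      unfolding C_def using j loc_degree_le[of j n]
      by (intro loc_fun_interpolation_error[OF \<alpha> n f _ _ _ x]) auto
    also have "\<dots> \<le> mesh_step \<alpha> n j / 2 * (4 * R * C)"
      using mesh_step_pos[OF \<alpha> n, of j] j
      by (intro mult_left_mono mult_right_mono factor C) auto
    finally show "\<bar>loc_fun \<alpha> n j f x
        - poly (lagrange_poly (cheb_node (loc_degree n j)) (loc_degree n j) (loc_fun \<alpha> n j f)) x\<bar>
      \<le> mesh_step \<alpha> n j / 2 * (4 * R * C)" .
  qed
  \<comment> \<open>The last factor \<open>\<alpha>\<close> is the one contributed by the Gaussian
    mass.\<close>
  have "(2 * \<alpha>) powr (- real n - 1) = 1 / (2 ^ (n + 1) * \<alpha> ^ n * \<alpha>)"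
  proof -
    have "- real n - 1 = - real (n + 1)" by simp
    moreover have "(2 * \<alpha>) powr real (n + 1) = (2 * \<alpha>) ^ (n + 1)"
      using \<alpha> by (intro powr_realpow) simp
    ultimately have "(2 * \<alpha>) powr (- real n - 1) = 1 / (2 * \<alpha>) ^ (n + 1)"
      by (simp only: powr_minus_divide)
    then show ?thesis by (simp add: power_mult_distrib mult_ac)
  qed
  then have "4 * R * C * (2 / \<alpha>)
      = 8 * (real n + 1) powr (- 1 / 2) * (2 * \<alpha>) powr (- real n - 1) * C"
    by (simp add: R_def mult_ac)
  with err show ?thesis unfolding C_def by simp
qed

theorem theorem4p4:
  fixes f :: "real \<Rightarrow> real"
  assumes "smooth_fun_on {0..1} f"
  shows "(\<exists>c>0. \<forall>\<alpha>>1. \<forall>n::nat. n \<ge> 1 \<longrightarrow>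
            (real n - 1) * (ln (real n + 1 + exp 1) - 1) \<ge> ln \<alpha> \<longrightarrow>
            comp_quad_error \<alpha> n f
              \<le> c * (real n + 1) powr (- 1 / 2) * (2 * \<alpha>) powr (- real n - 1)
                  * C_norm_on {0..1} ((n - 1) * n + 1) f)
       \<and> (\<forall>n::nat. n > 1 \<longrightarrow>
            real (comp_quad_nodes n) \<le> real n * (real n - 1) * ln (real n) + (real n)\<^sup>2 + real n)"
proof (intro conjI exI[of _ "8 :: real"] allI impI)
  fix \<alpha> :: real and n :: nat
  assume \<alpha>: "\<alpha> > 1" and "n \<ge> 1"
    and cond: "(real n - 1) * (ln (real n + 1 + exp 1) - 1) \<ge> ln \<alpha>"
  \<comment> \<open>At \<open>n = 1\<close> the left side of the condition is 0, while
    \<open>ln \<alpha>\<close> is positive.\<close>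
  have "n \<noteq> 1"
  proof
    assume "n = 1"
    then have "ln \<alpha> \<le> 0" using cond by simp
    then show False using ln_gt_zero[OF \<alpha>] by simp
  qed
  then show "comp_quad_error \<alpha> n f
      \<le> 8 * (real n + 1) powr (- 1 / 2) * (2 * \<alpha>) powr (- real n - 1)
          * C_norm_on {0..1} ((n - 1) * n + 1) f"
    using \<open>n \<ge> 1\<close> by (intro comp_quad_error_bound assms \<alpha> cond) simp
qed (use comp_quad_nodes_le in auto)

end
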